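(* Let $v:\Omega\to\mathbb{H}$ be the function $v(x)=-ixi$, where $i\in\mathbb{S}_{\mathbb{H}}$ is the standard quaternionic unit. Then: \begin{itemize} \item $v\in\bigcap_{n\geq2}\mathcal{SP}_n(\Omega,\mathbb{H})$; \item $v\notin\bigcup_{n\geq1}\mathcal{SP}^n(\Omega,\mathbb{H})$; \item $v$ is not a (left) slice function; \item $v$ and the inclusion function $x:\Omega\hookrightarrow\mathbb{H}$ are distinct elements of $\bigcap_{n\geq2}\mathcal{SP}_n(\Omega,\mathbb{H})$ which coincide on the whole $\Omega_i=\Omega\cap\mathbb{C}_i$; \item for every $\alpha_0+i\beta_0\in D$ with $\alpha_0,\beta_0\in\mathbb{R}$ and $\beta_0>0$, there do not exist $a_0,b_0\in\mathbb{H}$ such that $v(\alpha_0+I\beta_0)=a_0+Ib_0$ for all $I\in\mathbb{S}_{\mathbb{H}}$. \end{itemize}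
   Context: $\mathbb{H}$ is the real algebra of quaternions with standard units $i,j,k$, with the Euclidean topology and real analytic structure of $\mathbb{R}^4$. $\mathbb{S}_{\mathbb{H}}=\{I\in\mathbb{H}:I^2=-1\}$ and, for $I\in\mathbb{S}_{\mathbb{H}}$, $\mathbb{C}_I=\{\alpha+I\beta:\alpha,\beta\in\mathbb{R}\}$. A subset of $\mathbb{H}$ is circular if it has the form $\Omega_E=\{\alpha+I\beta:\alpha,\beta\in\mathbb{R},\ \alpha+i\beta\in E,\ I\in\mathbb{S}_{\mathbb{H}}\}$ for some $E\subset\mathbb{C}$. Fixed throughout: $\Omega$ is a non-empty connected circular open subset of $\mathbb{H}$ with $\Omega\cap\mathbb{R}\neq\emptyset$, and $D\subset\mathbb{C}$ is the (non-empty, connected, open, conjugation-invariant) set with $\Omega=\Omega_D$, i.e. $D=\{\alpha+i\beta:\alpha+I\beta\in\Omega\text{ for all }I\in\mathbb{S}_{\mathbb{H}}\}$. Put $\Omega_I=\Omega\cap\mathbb{C}_I$, $\phi_I:D\to\Omega_I$, $\phi_I(\alpha+i\beta)=\alpha+I\beta$, and $f_I=f|_{\Omega_I}$ for $f:\Omega\to\mathbb{H}$. $\mathscr{C}^n(\Omega,\mathbb{H})$ is the set of functions $\Omega\to\mathbb{H}$ of class $\mathscr{C}^n$ in the real sense. For $n\geq1$ and $g:\Omega_I\to\mathbb{H}$ with $g\circ\phi_I$ of class $\mathscr{C}^n$, $\overline{\partial}_I^{\,n} g(x)=\frac1{2^n}\Big(\big(\frac{\partial}{\partial\alpha}+I\frac{\partial}{\partial\beta}\big)^n(g\circ\phi_I)\Big)(\phi_I^{-1}(x))$,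 and $\overline{\partial}_I=\overline{\partial}_I^{\,1}$. $\mathcal{SR}(\Omega,\mathbb{H})$ (slice regular functions) is the set of $f\in\mathscr{C}^1(\Omega,\mathbb{H})$ with $\overline{\partial}_I f_I=0$ on $\Omega_I$ for all $I\in\mathbb{S}_{\mathbb{H}}$. $\mathcal{SP}_n(\Omega,\mathbb{H})$ (slice polyanalytic functions of order $n$) is the set of $f\in\mathscr{C}^n(\Omega,\mathbb{H})$ with $\overline{\partial}_I^{\,n} f_I=0$ on $\Omega_I$ for all $I\in\mathbb{S}_{\mathbb{H}}$. $\mathcal{SP}^n(\Omega,\mathbb{H})$ (global slice polyanalytic functions of order $n$) is the set of $f:\Omega\to\mathbb{H}$ for which there exist $f_0,\ldots,f_{n-1}\in\mathcal{SR}(\Omega,\mathbb{H})$ with $f(x)=\sum_{h=0}^{n-1}\overline{x}^hf_h(x)$ for all $x\in\Omega$, where $\overline{x}$ is quaternionic conjugation. A function $f:\Omega\to\mathbb{H}$ is a (left) slice function if there are $F_1,F_2:D\to\mathbb{H}$ with $F_1(\overline z)=F_1(z)$, $F_2(\overline z)=-F_2(z)$ for all $z\in D$ and $f(\alpha+I\beta)=F_1(\alpha+i\beta)+IF_2(\alpha+i\beta)$ for all $\alpha+i\beta\in D$ and $I\in\mathbb{S}_{\mathbb{H}}$. *)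

theory Defs
  imports "HOL-Analysis.Analysis"
begin

section \<open>The real normed division algebra of quaternions\<close>

datatype quat = Quat (qRe: real) (qIm1: real) (qIm2: real) (qIm3: real)

lemma quat_eq_iff:
  "x = y \<longleftrightarrow> qRe x = qRe y \<and> qIm1 x = qIm1 y \<and> qIm2 x = qIm2 y \<and> qIm3 x = qIm3 y"
  by (cases x; cases y) simp

instantiation quat :: real_vector
begin

definition "0 = Quat 0 0 0 0"
definition "x + y = Quat (qRe x + qRe y) (qIm1 x + qIm1 y) (qIm2 x + qIm2 y) (qIm3 x + qIm3 y)"
definition "- x = Quat (- qRe x) (- qIm1 x) (- qIm2 x) (- qIm3 x)"
definition "x - y = Quat (qRe x - qRe y) (qIm1 x - qIm1 y) (qIm2 x - qIm2 y) (qIm3 x - qIm3 y)"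
definition "r *\<^sub>R x = Quat (r * qRe x) (r * qIm1 x) (r * qIm2 x) (r * qIm3 x)"

instance
  by standard
    (simp_all add: quat_eq_iff zero_quat_def plus_quat_def uminus_quat_def minus_quat_def
      scaleR_quat_def algebra_simps)

end

lemma quat_linear_sel [simp]:
  "qRe 0 = 0" "qIm1 0 = 0" "qIm2 0 = 0" "qIm3 0 = 0"
  "qRe (x + y) = qRe x + qRe y" "qIm1 (x + y) = qIm1 x + qIm1 y"
  "qIm2 (x + y) = qIm2 x + qIm2 y" "qIm3 (x + y) = qIm3 x + qIm3 y"
  "qRe (- x) = - qRe x" "qIm1 (- x) = - qIm1 x" "qIm2 (- x) = - qIm2 x" "qIm3 (- x) = - qIm3 x"
  "qRe (x - y) = qRe x - qRe y" "qIm1 (x - y) = qIm1 x - qIm1 y"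
  "qIm2 (x - y) = qIm2 x - qIm2 y" "qIm3 (x - y) = qIm3 x - qIm3 y"
  "qRe (r *\<^sub>R x) = r * qRe x" "qIm1 (r *\<^sub>R x) = r * qIm1 x"
  "qIm2 (r *\<^sub>R x) = r * qIm2 x" "qIm3 (r *\<^sub>R x) = r * qIm3 x"
  by (simp_all add: zero_quat_def plus_quat_def uminus_quat_def minus_quat_def scaleR_quat_def)

instantiation quat :: real_algebra_1
begin

definition "1 = Quat 1 0 0 0"
definition "x * y = Quat
  (qRe x * qRe y - qIm1 x * qIm1 y - qIm2 x * qIm2 y - qIm3 x * qIm3 y)
  (qRe x * qIm1 y + qIm1 x * qRe y + qIm2 x * qIm3 y - qIm3 x * qIm2 y)
  (qRe x * qIm2 y - qIm1 x * qIm3 y + qIm2 x * qRe y + qIm3 x * qIm1 y)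
  (qRe x * qIm3 y + qIm1 x * qIm2 y - qIm2 x * qIm1 y + qIm3 x * qRe y)"

instance
  by standard (simp_all add: quat_eq_iff one_quat_def times_quat_def algebra_simps)

end

lemma quat_mult_sel [simp]:
  "qRe 1 = 1" "qIm1 1 = 0" "qIm2 1 = 0" "qIm3 1 = 0"
  "qRe (x * y) = qRe x * qRe y - qIm1 x * qIm1 y - qIm2 x * qIm2 y - qIm3 x * qIm3 y"
  "qIm1 (x * y) = qRe x * qIm1 y + qIm1 x * qRe y + qIm2 x * qIm3 y - qIm3 x * qIm2 y"
  "qIm2 (x * y) = qRe x * qIm2 y - qIm1 x * qIm3 y + qIm2 x * qRe y + qIm3 x * qIm1 y"
  "qIm3 (x * y) = qRe x * qIm3 y + qIm1 x * qIm2 y - qIm2 x * qIm1 y + qIm3 x * qRe y"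
  by (simp_all add: one_quat_def times_quat_def)

definition qcnj :: "quat \<Rightarrow> quat" where
  "qcnj x = Quat (qRe x) (- qIm1 x) (- qIm2 x) (- qIm3 x)"

lemma qcnj_sel [simp]:
  "qRe (qcnj x) = qRe x" "qIm1 (qcnj x) = - qIm1 x"
  "qIm2 (qcnj x) = - qIm2 x" "qIm3 (qcnj x) = - qIm3 x"
  by (simp_all add: qcnj_def)

instantiation quat :: real_normed_div_algebra
begin

definition norm_quat_def:
  "norm x = sqrt ((qRe x)\<^sup>2 + (qIm1 x)\<^sup>2 + (qIm2 x)\<^sup>2 + (qIm3 x)\<^sup>2)"

definition sgn_quat_def: "sgn (x::quat) = x /\<^sub>R norm x"

definition dist_quat_def: "dist (x::quat) y = norm (x - y)"

definition uniformity_quat_def: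
  "(uniformity :: (quat \<times> quat) filter) = (INF e\<in>{0<..}. principal {(x, y). dist x y < e})"

definition open_quat_def:
  "open (U :: quat set) \<longleftrightarrow> (\<forall>x\<in>U. eventually (\<lambda>(x', y). x' = x \<longrightarrow> y \<in> U) uniformity)"

definition inverse_quat_def: "inverse x = qcnj x /\<^sub>R (norm x)\<^sup>2"

definition divide_quat_def: "divide (x::quat) y = x * inverse y"

instance
proof
  fix r :: real and x y :: quat and S :: "quat set"
  show norm0: "norm x = 0 \<longleftrightarrow> x = 0" for x :: quat
    by (simp add: norm_quat_def quat_eq_iff add_nonneg_eq_0_iff)
  have tuple: "norm x = norm (qRe x, qIm1 x, qIm2 x, qIm3 x)" for x :: quat
    by (simp add: norm_quat_def norm_prod_def add.assoc)
  show "norm (x + y) \<le> norm x + norm y"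
    using norm_triangle_ineq[of "(qRe x, qIm1 x, qIm2 x, qIm3 x)" "(qRe y, qIm1 y, qIm2 y, qIm3 y)"]
    by (simp add: tuple)
  show "norm (r *\<^sub>R x) = \<bar>r\<bar> * norm x"
    by (simp add: norm_quat_def power_mult_distrib distrib_left [symmetric] real_sqrt_mult)
  show "norm (x * y) = norm x * norm y"
    unfolding norm_quat_def real_sqrt_mult [symmetric]
    by (rule arg_cong[where f = sqrt]) (simp add: power2_eq_square algebra_simps)
  have sq: "(norm x)\<^sup>2 = (qRe x)\<^sup>2 + (qIm1 x)\<^sup>2 + (qIm2 x)\<^sup>2 + (qIm3 x)\<^sup>2" for x :: quat
    by (simp add: norm_quat_def)
  have cl: "qcnj x * x = (norm x)\<^sup>2 *\<^sub>R 1" and cr: "x * qcnj x = (norm x)\<^sup>2 *\<^sub>R 1" for x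
    unfolding sq by (simp_all add: quat_eq_iff power2_eq_square)
  show "inverse x * x = 1" if "x \<noteq> 0"
    using that norm0[of x] cl[of x] by (simp add: inverse_quat_def)
  show "x * inverse x = 1" if "x \<noteq> 0"
    using that norm0[of x] cr[of x] by (simp add: inverse_quat_def)
  show "inverse (0::quat) = 0"
    by (simp add: inverse_quat_def quat_eq_iff)
qed (rule sgn_quat_def dist_quat_def open_quat_def uniformity_quat_def divide_quat_def)+

end

definition quat_i :: quat where "quat_i = Quat 0 1 0 0"
definition quat_j :: quat where "quat_j = Quat 0 0 1 0"
definition quat_k :: quat where "quat_k = Quat 0 0 0 1"

lemma quat_units_sel [simp]:
  "qRe quat_i = 0" "qIm1 quat_i = 1" "qIm2 quat_i = 0" "qIm3 quat_i = 0"
  "qRe quat_j = 0" "qIm1 quat_j = 0" "qIm2 quat_j = 1" "qIm3 quat_j = 0"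
  "qRe quat_k = 0" "qIm1 quat_k = 0" "qIm2 quat_k = 0" "qIm3 quat_k = 1"
  by (simp_all add: quat_i_def quat_j_def quat_k_def)

lemma quat_unit_relations:
  "quat_i * quat_i = - 1" "quat_j * quat_j = - 1" "quat_k * quat_k = - 1"
  "quat_i * quat_j = quat_k" "quat_j * quat_k = quat_i" "quat_k * quat_i = quat_j"
  by (simp_all add: quat_eq_iff)

instantiation quat :: euclidean_space
begin

definition inner_quat_def:
  "inner x y = qRe x * qRe y + qIm1 x * qIm1 y + qIm2 x * qIm2 y + qIm3 x * qIm3 y"

definition Basis_quat_def: "Basis = {1, quat_i, quat_j, quat_k}"

instance
proof
  fix x y z :: quat and r :: real
  show "inner x y = inner y x" "inner (x + y) z = inner x z + inner y z"
    "inner (r *\<^sub>R x) y = r * inner x y" "0 \<le> inner x x"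
    by (simp_all add: inner_quat_def algebra_simps)
  show "inner x x = 0 \<longleftrightarrow> x = 0"
    by (simp add: inner_quat_def add_nonneg_eq_0_iff quat_eq_iff)
  show "norm x = sqrt (inner x x)"
    by (simp add: inner_quat_def norm_quat_def power2_eq_square)
  show "finite (Basis :: quat set)" "(Basis :: quat set) \<noteq> {}"
    by (simp_all add: Basis_quat_def)
  show "inner u w = (if u = w then 1 else 0)" if "u \<in> Basis" "w \<in> Basis" for u w :: quat
    using that by (auto simp: Basis_quat_def inner_quat_def quat_eq_iff)
  show "(\<forall>u\<in>Basis. inner x u = 0) \<longleftrightarrow> x = 0"
    by (simp add: Basis_quat_def inner_quat_def quat_eq_iff[of x])
qed

end


section \<open>Circular sets and slices\<close>

definition imag_units :: "quat set" where
  "imag_units = {I. I\<^sup>2 = - 1}"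

definition slice_plane :: "quat \<Rightarrow> quat set" where
  "slice_plane I = {of_real \<alpha> + I * of_real \<beta> | \<alpha> \<beta>. True}"

definition slice_embed :: "quat \<Rightarrow> complex \<Rightarrow> quat" where
  "slice_embed I z = of_real (Re z) + I * of_real (Im z)"

definition circularization :: "complex set \<Rightarrow> quat set" where
  "circularization E = {slice_embed I z | I z. I \<in> imag_units \<and> z \<in> E}"

definition circular :: "quat set \<Rightarrow> bool" where
  "circular A \<longleftrightarrow> (\<exists>E. A = circularization E)"

definition slice_domain :: "quat set \<Rightarrow> complex set" where
  "slice_domain \<Omega> = {z. \<forall>I\<in>imag_units. slice_embed I z \<in> \<Omega>}"


section \<open>Slice polyanalytic functions\<close>

text \<open>
  Functions on an open set \<open>\<Omega>\<close> are total functions of which only the values on \<open>\<Omega>\<close> matter;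
  as \<open>\<Omega>\<close> is open, all derivatives below depend on these values only.
\<close>

text \<open>Class \<open>C\<^sup>n\<close> in the real sense on an open set, by recursion over directional derivatives.\<close>

fun Cn_on :: "nat \<Rightarrow> 'a::euclidean_space set \<Rightarrow> ('a \<Rightarrow> 'b::euclidean_space) \<Rightarrow> bool" where
  "Cn_on 0 S f \<longleftrightarrow> continuous_on S f"
| "Cn_on (Suc n) S f \<longleftrightarrow>
    (\<forall>x\<in>S. f differentiable (at x)) \<and> (\<forall>v. Cn_on n S (\<lambda>x. frechet_derivative f (at x) v))"

text \<open>The operator \<open>\<partial>/\<partial>\<alpha> + I \<partial>/\<partial>\<beta>\<close>, with the unit acting by left multiplication.\<close>

definition cauchy_riemann_op :: "quat \<Rightarrow> (complex \<Rightarrow> quat) \<Rightarrow> complex \<Rightarrow> quat" where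
  "cauchy_riemann_op I G z =
     vector_derivative (\<lambda>\<alpha>. G (Complex \<alpha> (Im z))) (at (Re z)) +
     I * vector_derivative (\<lambda>\<beta>. G (Complex (Re z) \<beta>)) (at (Im z))"

text \<open>
  For an imaginary unit \<open>I\<close>, the map \<open>slice_embed I\<close> is a bijection from the complex numbers onto
  \<open>slice_plane I\<close>, so its inverse extends the inverse of its restriction to \<open>slice_domain \<Omega>\<close>.
\<close>

definition dbar :: "quat \<Rightarrow> nat \<Rightarrow> (quat \<Rightarrow> quat) \<Rightarrow> quat \<Rightarrow> quat" where
  "dbar I n g x =
     (1 / 2 ^ n) *\<^sub>R (cauchy_riemann_op I ^^ n) (g \<circ> slice_embed I) (inv (slice_embed I) x)"

definition slice_regular :: "quat set \<Rightarrow> (quat \<Rightarrow> quat) set" where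
  "slice_regular \<Omega> =
     {f. Cn_on 1 \<Omega> f \<and> (\<forall>I\<in>imag_units. \<forall>x\<in>\<Omega> \<inter> slice_plane I. dbar I 1 f x = 0)}"

definition slice_polyanalytic :: "nat \<Rightarrow> quat set \<Rightarrow> (quat \<Rightarrow> quat) set" where
  "slice_polyanalytic n \<Omega> =
     {f. Cn_on n \<Omega> f \<and> (\<forall>I\<in>imag_units. \<forall>x\<in>\<Omega> \<inter> slice_plane I. dbar I n f x = 0)}"

definition global_slice_polyanalytic :: "nat \<Rightarrow> quat set \<Rightarrow> (quat \<Rightarrow> quat) set" where
  "global_slice_polyanalytic n \<Omega> =
     {f. \<exists>F :: nat \<Rightarrow> quat \<Rightarrow> quat. (\<forall>h<n. F h \<in> slice_regular \<Omega>) \<and>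
           (\<forall>x\<in>\<Omega>. f x = (\<Sum>h<n. qcnj x ^ h * F h x))}"

definition slice_function :: "quat set \<Rightarrow> (quat \<Rightarrow> quat) \<Rightarrow> bool" where
  "slice_function \<Omega> f \<longleftrightarrow>
     (\<exists>F1 F2 :: complex \<Rightarrow> quat.
        (\<forall>z\<in>slice_domain \<Omega>. F1 (cnj z) = F1 z \<and> F2 (cnj z) = - F2 z) \<and>
        (\<forall>z\<in>slice_domain \<Omega>. \<forall>I\<in>imag_units. f (slice_embed I z) = F1 z + I * F2 z))"

end

theory Submission
  imports Defs "HOL-Complex_Analysis.Conformal_Mappings"
begin

text \<open>
  The map \<open>v\<close> is real linear, so applying \<open>\<partial>/\<partial>\<alpha> + I \<partial>/\<partial>\<beta>\<close> once on a slice gives a constant and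
  applying it twice gives zero. This puts \<open>v\<close>, like the identity, in every class of order at
  least two (\<open>slice_polyanalytic_linear\<close>).

  The main point is that \<open>v\<close> is not a finite sum \<open>\<Sum>h. qcnj x ^ h * f\<^sub>h x\<close> with slice regular \<open>f\<^sub>h\<close>.
  On the slice of \<open>quat_i\<close> it equals \<open>x\<close>, so there the sum with \<open>f\<^sub>0\<close> replaced by \<open>f\<^sub>0 - x\<close>
  vanishes. In complex coordinates this is a vanishing sum \<open>\<Sum>h. cnj z ^ h * G\<^sub>h z\<close> with
  holomorphic \<open>G\<^sub>h\<close>, and such sums have zero coefficients (\<open>polyanalytic_unique\<close>). In particular
  \<open>f\<^sub>0 - x, f\<^sub>1, f\<^sub>2, \<dots>\<close> vanish at the real points near a given real point of \<open>\<Omega>\<close>. Real points lie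
  on every slice, and on each of them the coefficients are holomorphic, so the identity theorem
  makes them vanish on every slice near that point (\<open>slice_combination_zero_transfer\<close>). Hence
  \<open>v x = x\<close> there, which fails on the slice of \<open>quat_j\<close>, where \<open>v\<close> is conjugation.

  On a sphere \<open>\<alpha> + I \<beta>\<close> with \<open>\<beta> > 0\<close>, the values of \<open>v\<close> at \<open>I = quat_i\<close> and \<open>I = - quat_i\<close> force
  any representation \<open>a + I * b\<close> to have \<open>a = \<alpha>\<close> and \<open>b = \<beta>\<close>, contradicting the value at
  \<open>I = quat_j\<close>. A slice function has such a representation on each sphere, and the open set \<open>\<Omega>\<close>,
  having a real point, contains a sphere with \<open>\<beta> > 0\<close>; so \<open>v\<close> is not a slice function.
\<close>

section \<open>Slices and their complex coordinates\<close>

lemma imag_units_mult: "I \<in> imag_units \<Longrightarrow> I * I = - 1"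
  by (simp add: imag_units_def power2_eq_square)

lemma quat_units_imag [simp]:
  "quat_i \<in> imag_units" "- quat_i \<in> imag_units" "quat_j \<in> imag_units"
  by (simp_all add: imag_units_def power2_eq_square quat_unit_relations)

lemma of_real_quat_sel [simp]:
  "qRe (of_real r) = r" "qIm1 (of_real r) = 0" "qIm2 (of_real r) = 0" "qIm3 (of_real r) = 0"
  by (simp_all add: of_real_def)

lemma imag_units_sel:
  assumes "I \<in> imag_units"
  shows "qRe I = 0" "(qIm1 I)\<^sup>2 + (qIm2 I)\<^sup>2 + (qIm3 I)\<^sup>2 = 1"
proof -
  have *: "qRe I * qRe I - qIm1 I * qIm1 I - qIm2 I * qIm2 I - qIm3 I * qIm3 I = - 1"
    "qRe I * qIm1 I = 0" "qRe I * qIm2 I = 0" "qRe I * qIm3 I = 0"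
    using imag_units_mult[OF assms] by (auto simp: quat_eq_iff)
  show re: "qRe I = 0"
  proof (rule ccontr)
    assume "qRe I \<noteq> 0"
    then have "qRe I * qRe I = - 1" using * by simp
    then show False using zero_le_square[of "qRe I"] by linarith
  qed
  show "(qIm1 I)\<^sup>2 + (qIm2 I)\<^sup>2 + (qIm3 I)\<^sup>2 = 1"
    using * re by (simp add: power2_eq_square)
qed

lemma norm_slice_embed:
  assumes "I \<in> imag_units"
  shows "norm (slice_embed I z) = norm z"
proof -
  have "(Im z * qIm1 I)\<^sup>2 + (Im z * qIm2 I)\<^sup>2 + (Im z * qIm3 I)\<^sup>2
      = (Im z)\<^sup>2 * ((qIm1 I)\<^sup>2 + (qIm2 I)\<^sup>2 + (qIm3 I)\<^sup>2)"
    by (simp add: algebra_simps power_mult_distrib)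
  then show ?thesis
    using imag_units_sel[OF assms]
    by (simp add: slice_embed_def norm_quat_def cmod_def mult.commute add.assoc)
qed

lemma bounded_linear_slice_embed: "bounded_linear (slice_embed I)"
  unfolding slice_embed_def[abs_def]
  by (intro bounded_linear_add bounded_linear_const_mult bounded_linear_compose[OF bounded_linear_of_real]
      bounded_linear_Re bounded_linear_Im)

lemma slice_embed_diff: "slice_embed I (z - w) = slice_embed I z - slice_embed I w"
  by (rule linear_diff[OF bounded_linear.linear[OF bounded_linear_slice_embed]])

lemma slice_embed_of_real [simp]: "slice_embed I (of_real r) = of_real r"
  by (simp add: slice_embed_def)

lemma dist_of_real_slice_embed:
  assumes "I \<in> imag_units"
  shows "dist (of_real r) (slice_embed I z) = dist (of_real r) z"
  using norm_slice_embed[OF assms, of "of_real r - z"] by (simp add: dist_norm slice_embed_diff)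

lemma inv_slice_embed:
  assumes "I \<in> imag_units"
  shows "inv (slice_embed I) (slice_embed I z) = z"
proof (rule inv_f_f, rule injI)
  fix z w assume "slice_embed I z = slice_embed I w"
  then have "slice_embed I (z - w) = 0"
    by (simp add: slice_embed_diff)
  then have "norm (z - w) = 0"
    using norm_slice_embed[OF assms, of "z - w"] by simp
  then show "z = w" by simp
qed

lemma slice_plane_eq_range: "slice_plane I = range (slice_embed I)"
proof
  have "of_real a + I * of_real b = slice_embed I (Complex a b)" for a b
    by (simp add: slice_embed_def)
  then show "slice_plane I \<subseteq> range (slice_embed I)"
    by (auto simp: slice_plane_def)
qed (auto simp: slice_plane_def slice_embed_def)

text \<open>
  Left multiplication by an imaginary unit \<open>I\<close> makes the quaternions a complex vector space. The
  following is the complex linear functional on it whose real part is the inner product with \<open>w\<close>.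
  Letting \<open>w\<close> vary gives enough functionals to separate points without choosing a unit orthogonal
  to \<open>I\<close>; this replaces the usual splitting of a function into two complex components.
\<close>

definition slice_coord :: "quat \<Rightarrow> quat \<Rightarrow> quat \<Rightarrow> complex" where
  "slice_coord I w q = Complex (q \<bullet> w) (- ((I * q) \<bullet> w))"

lemma bounded_linear_slice_coord: "bounded_linear (slice_coord I w)"
proof -
  have eq: "slice_coord I w = (\<lambda>q. of_real (q \<bullet> w) + \<i> * of_real (- ((I * q) \<bullet> w)))"
    by (auto simp: slice_coord_def complex_eq_iff)
  show ?thesis
    unfolding eq
    by (intro bounded_linear_add bounded_linear_const_mult bounded_linear_minus
        bounded_linear_compose[OF bounded_linear_of_real]
        bounded_linear_compose[OF bounded_linear_inner_left]
        bounded_linear_mult_right bounded_linear_ident)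
qed

lemma slice_coord_linear_simps [simp]:
  "slice_coord I w 0 = 0"
  "slice_coord I w (p - q) = slice_coord I w p - slice_coord I w q"
  "slice_coord I w (sum f A) = (\<Sum>a\<in>A. slice_coord I w (f a))"
  by (rule linear_0 linear_diff linear_sum;
      rule bounded_linear.linear[OF bounded_linear_slice_coord])+

lemma slice_coord_mult:
  assumes "I \<in> imag_units"
  shows "slice_coord I w (slice_embed I z * q) = z * slice_coord I w q"
proof -
  have "I * (I * q) = - q"
    using imag_units_mult[OF assms] by (simp flip: mult.assoc)
  then show ?thesis
    by (auto simp: slice_embed_def slice_coord_def complex_eq_iff algebra_simps
        of_real_def inner_add_left)
qed

lemma slice_coord_eqD:
  assumes "\<And>w. slice_coord I w p = slice_coord I w q"
  shows "p = q"
proof -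
  have "p \<bullet> w = q \<bullet> w" for w
    using assms[of w] by (simp add: slice_coord_def)
  then show ?thesis using vector_eq_rdot by blast
qed

section \<open>The function \<open>v\<close> is slice polyanalytic\<close>

lemma frechet_derivative_cong_open:
  assumes "open S" "x \<in> S" "\<And>y. y \<in> S \<Longrightarrow> f y = g y"
  shows "frechet_derivative f (at x) = frechet_derivative g (at x)"
proof -
  have "(f has_derivative D) (at x) \<longleftrightarrow> (g has_derivative D) (at x)" for D
    using has_derivative_transform_within_open[of f D x UNIV S g]
      has_derivative_transform_within_open[of g D x UNIV S f] assms by auto
  then show ?thesis by (simp add: frechet_derivative_def)
qed

text \<open>
  The function \<open>v\<close> is prescribed on \<open>\<Omega>\<close> only, so its smoothness and its iterated Cauchy-Riemann
  derivatives have to be carried over from the linear map that it agrees with there.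
\<close>

lemma Cn_on_cong_open:
  assumes "open S" "\<And>y. y \<in> S \<Longrightarrow> f y = g y" "Cn_on n S f"
  shows "Cn_on n S g"
  using assms(2,3)
proof (induction n arbitrary: f g)
  case 0
  then show ?case by (simp cong: continuous_on_cong)
next
  case (Suc n)
  have "g differentiable (at x)" if "x \<in> S" for x
    using Suc.prems that has_derivative_transform_within_open[OF _ assms(1) that]
    by (force simp: differentiable_def)
  moreover have "Cn_on n S (\<lambda>x. frechet_derivative g (at x) u)" for u
  proof (rule Suc.IH)
    show "Cn_on n S (\<lambda>x. frechet_derivative f (at x) u)"
      using Suc.prems by simp
    show "frechet_derivative f (at x) u = frechet_derivative g (at x) u" if "x \<in> S" for x
      using frechet_derivative_cong_open[OF assms(1) that] Suc.prems(1) by metis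
  qed
  ultimately show ?case by simp
qed

lemma Cn_on_const: "Cn_on n S (\<lambda>x. c)"
  by (induction n arbitrary: c) (simp_all add: frechet_derivative_const)

lemma Cn_on_bounded_linear:
  assumes "bounded_linear L"
  shows "Cn_on n S L"
proof (cases n)
  case 0
  then show ?thesis using assms by (simp add: linear_continuous_on)
next
  case (Suc m)
  have "(L has_derivative L) (at x)" for x
    using assms by (rule bounded_linear_imp_has_derivative)
  then have "L differentiable at x" "frechet_derivative L (at x) = L" for x
    by (auto simp: differentiable_def intro: frechet_derivative_at[symmetric])
  then show ?thesis using Suc by (simp add: Cn_on_const)
qed

lemma cauchy_riemann_op_has_derivative:
  assumes "(G has_derivative G') (at z)"
  shows "cauchy_riemann_op I G z = G' 1 + I * G' \<i>"
proof -
  have lin: "linear G'" using assms by (rule has_derivative_linear)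
  have 1: "((\<lambda>a. Complex a (Im z)) has_vector_derivative 1) (at (Re z))"
  proof -
    have "(\<lambda>a. Complex a (Im z)) = (\<lambda>a. of_real a + \<i> * of_real (Im z))"
      by (auto simp: complex_eq_iff)
    then show ?thesis by (auto intro!: derivative_eq_intros)
  qed
  have 2: "((\<lambda>b. Complex (Re z) b) has_vector_derivative \<i>) (at (Im z))"
  proof -
    have "(\<lambda>b. Complex (Re z) b) = (\<lambda>b. of_real (Re z) + \<i> * of_real b)"
      by (auto simp: complex_eq_iff)
    then show ?thesis by (auto intro!: derivative_eq_intros)
  qed
  have a: "((\<lambda>a. G (Complex a (Im z))) has_vector_derivative G' 1) (at (Re z))"
    using has_derivative_compose[OF 1[unfolded has_vector_derivative_def], of G G'] assms
    by (simp add: has_vector_derivative_def linear_scale[OF lin])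
  have b: "((\<lambda>b. G (Complex (Re z) b)) has_vector_derivative G' \<i>) (at (Im z))"
    using has_derivative_compose[OF 2[unfolded has_vector_derivative_def], of G G'] assms
    by (simp add: has_vector_derivative_def linear_scale[OF lin])
  show ?thesis
    unfolding cauchy_riemann_op_def
    using vector_derivative_at[OF a] vector_derivative_at[OF b] by simp
qed

lemma cauchy_riemann_op_cong_open:
  assumes "open U" "\<And>y. y \<in> U \<Longrightarrow> G y = H y" "z \<in> U"
  shows "cauchy_riemann_op I G z = cauchy_riemann_op I H z"
proof -
  have ev: "eventually (\<lambda>y. G y = H y) (nhds z)"
    using assms eventually_nhds by blast
  have "((\<lambda>a. Complex a (Im z)) \<longlongrightarrow> z) (nhds (Re z))"
    "((\<lambda>b. Complex (Re z) b) \<longlongrightarrow> z) (nhds (Im z))"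
    by (auto simp: tendsto_complex_iff intro: filterlim_ident)
  then have "eventually (\<lambda>a. G (Complex a (Im z)) = H (Complex a (Im z))) (nhds (Re z))"
    "eventually (\<lambda>b. G (Complex (Re z) b) = H (Complex (Re z) b)) (nhds (Im z))"
    using ev by (auto elim!: eventually_compose_filterlim)
  then show ?thesis
    unfolding cauchy_riemann_op_def
    by (intro arg_cong2[where f = "(+)"] arg_cong2[where f = "(*)"] refl vector_derivative_cong_eq)
      auto
qed

lemma cauchy_riemann_op_funpow_cong_open:
  assumes "open U" "\<And>y. y \<in> U \<Longrightarrow> G y = H y" "z \<in> U"
  shows "(cauchy_riemann_op I ^^ n) G z = (cauchy_riemann_op I ^^ n) H z"
  using assms(3)
proof (induction n arbitrary: z)
  case (Suc n)
  then show ?case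
    using cauchy_riemann_op_cong_open[OF assms(1), of "(cauchy_riemann_op I ^^ n) G"] by simp
qed (simp add: assms(2))

lemma cauchy_riemann_op_const: "cauchy_riemann_op I (\<lambda>_. c) = (\<lambda>_. 0)"
  by (rule ext, subst cauchy_riemann_op_has_derivative[where G' = "\<lambda>_. 0"]) auto

text \<open>
  A real linear map composed with a slice embedding has constant partial derivatives, so its
  second and higher Cauchy-Riemann derivatives vanish.
\<close>

lemma slice_polyanalytic_linear:
  assumes "open \<Omega>" "bounded_linear L" "\<And>x. x \<in> \<Omega> \<Longrightarrow> f x = L x" "2 \<le> n"
  shows "f \<in> slice_polyanalytic n \<Omega>"
proof -
  have "Cn_on n \<Omega> f"
    using Cn_on_cong_open[OF assms(1) _ Cn_on_bounded_linear[OF assms(2)]] assms(3) by metis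
  moreover have "dbar I n f x = 0" if I: "I \<in> imag_units" and x: "x \<in> \<Omega> \<inter> slice_plane I" for I x
  proof -
    obtain z where z: "x = slice_embed I z"
      using x slice_plane_eq_range by auto
    obtain m where m: "n = Suc (Suc m)"
      using assms(4) by (metis One_nat_def Suc_1 Suc_le_D Suc_le_mono)
    let ?G = "L \<circ> slice_embed I"
    have "bounded_linear ?G"
      unfolding comp_def by (intro bounded_linear_compose[OF assms(2)] bounded_linear_slice_embed)
    then have 1: "cauchy_riemann_op I ?G = (\<lambda>_. ?G 1 + I * ?G \<i>)"
      using cauchy_riemann_op_has_derivative[OF bounded_linear_imp_has_derivative] by blast
    have 2: "(cauchy_riemann_op I ^^ k) (\<lambda>_. 0) = (\<lambda>_. 0)" for k
      by (induction k) (simp_all add: cauchy_riemann_op_const)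
    have "(cauchy_riemann_op I ^^ n) (f \<circ> slice_embed I) z = (cauchy_riemann_op I ^^ n) ?G z"
    proof (rule cauchy_riemann_op_funpow_cong_open)
      show "open (slice_embed I -` \<Omega>)"
        by (intro open_vimage assms(1) linear_continuous_on bounded_linear_slice_embed)
    qed (use x z assms(3) in auto)
    also have "\<dots> = (cauchy_riemann_op I ^^ m) (cauchy_riemann_op I (cauchy_riemann_op I ?G)) z"
      by (simp add: m funpow_swap1)
    also have "\<dots> = 0"
      by (simp only: 1 2 cauchy_riemann_op_const)
    finally show ?thesis
      by (simp add: dbar_def z inv_slice_embed[OF I])
  qed
  ultimately show ?thesis by (simp add: slice_polyanalytic_def)
qed

section \<open>Slice regular functions in complex coordinates\<close>

text \<open>
  The equation \<open>D 1 + I * D I = 0\<close> for the real derivative \<open>D\<close> says \<open>D I = I * D 1\<close>: on the slice,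
  \<open>D\<close> commutes with left multiplication by \<open>I\<close>. Complex linear functionals then turn the slice
  restriction into holomorphic functions.
\<close>

lemma slice_regular_holomorphic:
  assumes "f \<in> slice_regular \<Omega>" "I \<in> imag_units"
  shows "(\<lambda>z. slice_coord I w (f (slice_embed I z))) holomorphic_on (slice_embed I -` \<Omega>)"
  unfolding holomorphic_on_def
proof
  fix z assume z: "z \<in> slice_embed I -` \<Omega>"
  define D where "D = frechet_derivative f (at (slice_embed I z))"
  have "Cn_on (Suc 0) \<Omega> f" and dbar: "\<forall>x\<in>\<Omega> \<inter> slice_plane I. dbar I 1 f x = 0"
    using assms unfolding slice_regular_def One_nat_def by blast+
  then have "f differentiable at (slice_embed I z)"
    using z unfolding Cn_on.simps by blast
  then have "(f has_derivative D) (at (slice_embed I z))"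
    by (simp add: D_def frechet_derivative_works)
  then have fd: "((\<lambda>z. f (slice_embed I z)) has_derivative (\<lambda>h. D (slice_embed I h))) (at z)"
    by (intro has_derivative_compose[OF bounded_linear_imp_has_derivative
          [OF bounded_linear_slice_embed]])
  have lin: "linear D"
    using \<open>(f has_derivative D) _\<close> by (rule has_derivative_linear)
  have "slice_embed I z \<in> \<Omega> \<inter> slice_plane I"
    using z slice_plane_eq_range by auto
  then have "dbar I 1 f (slice_embed I z) = 0"
    using dbar by blast
  then have "cauchy_riemann_op I (f \<circ> slice_embed I) z = 0"
    by (simp add: dbar_def inv_slice_embed[OF assms(2)])
  then have "D 1 + I * D I = 0"
    using cauchy_riemann_op_has_derivative[of "f \<circ> slice_embed I", OF fd[folded comp_def]]
    by (simp add: slice_embed_def)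
  then have "I * D 1 + (I * I) * D I = 0"
    by (metis distrib_left mult.assoc mult_zero_right)
  then have "D I = I * D 1"
    by (simp add: imag_units_mult[OF assms(2)])
  then have "D (slice_embed I h) = slice_embed I h * D 1" for h
    using linear_add[OF lin, of "Re h *\<^sub>R 1" "Im h *\<^sub>R I"]
    by (simp add: slice_embed_def of_real_def linear_scale[OF lin] distrib_right)
  then have "slice_coord I w (D (slice_embed I h)) = slice_coord I w (D 1) * h" for h
    using slice_coord_mult[OF assms(2)] by simp
  then have "((\<lambda>z. slice_coord I w (f (slice_embed I z))) has_field_derivative
      slice_coord I w (D 1)) (at z)"
    using bounded_linear.has_derivative[OF bounded_linear_slice_coord fd, of I w]
    by (simp add: has_field_derivative_def)
  then show "(\<lambda>z. slice_coord I w (f (slice_embed I z)))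
      field_differentiable at z within slice_embed I -` \<Omega>"
    using field_differentiable_at_within field_differentiable_def by blast
qed

section \<open>Uniqueness of polyanalytic expansions\<close>

text \<open>
  On the circle of radius \<open>\<rho>\<close> about \<open>c\<close> the conjugate is a meromorphic function of \<open>z\<close>, namely
  \<open>cnj z = cnj c + \<rho>\<^sup>2 / (z - c)\<close>. Substituting it and clearing denominators by \<open>(z - c) ^ n\<close> turns
  the sum into a holomorphic function on the disc that vanishes on the circle, hence also at the
  centre by the maximum principle. All terms but the leading one carry a factor \<open>z - c\<close>, so the
  value at the centre is a nonzero multiple of \<open>G n c\<close>.
\<close>

lemma polyanalytic_leading_zero:
  fixes G :: "nat \<Rightarrow> complex \<Rightarrow> complex"
  assumes "open U" and hol: "\<And>h. h \<le> n \<Longrightarrow> G h holomorphic_on U"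
    and zero: "\<And>z. z \<in> U \<Longrightarrow> (\<Sum>h\<le>n. cnj z ^ h * G h z) = 0"
    and "c \<in> U"
  shows "G n c = 0"
proof -
  obtain \<rho> where \<rho>: "\<rho> > 0" "cball c \<rho> \<subseteq> U"
    using assms(1) \<open>c \<in> U\<close> open_contains_cball by blast
  define P where
    "P z = (\<Sum>h\<le>n. (cnj c * (z - c) + of_real (\<rho>\<^sup>2)) ^ h * (z - c) ^ (n - h) * G h z)" for z
  have "P holomorphic_on U"
    unfolding P_def using hol by (intro holomorphic_intros) auto
  then have P: "P holomorphic_on cball c \<rho>"
    using \<rho>(2) holomorphic_on_subset by blast
  have "P z = 0" if "z \<in> sphere c \<rho>" for z
  proof -
    have "(z - c) * cnj (z - c) = of_real (\<rho>\<^sup>2)"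
      using that complex_norm_square[of "z - c"] by (simp add: dist_norm norm_minus_commute)
    then have "cnj c * (z - c) + of_real (\<rho>\<^sup>2) = (z - c) * cnj z"
      by (simp add: algebra_simps)
    then have "P z = (\<Sum>h\<le>n. (z - c) ^ n * (cnj z ^ h * G h z))"
      unfolding P_def
      by (intro sum.cong refl)
        (simp add: power_mult_distrib mult_ac
          flip: power_add mult.assoc[of "(z - c) ^ _" "(z - c) ^ _"])
    also have "\<dots> = (z - c) ^ n * (\<Sum>h\<le>n. cnj z ^ h * G h z)"
      by (simp add: sum_distrib_left)
    finally show ?thesis
      using zero[of z] that \<rho> by (auto simp: subset_iff)
  qed
  moreover have "P holomorphic_on interior (cball c \<rho>)" "continuous_on (closure (cball c \<rho>)) P"
    using P by (auto intro: holomorphic_on_subset holomorphic_on_imp_continuous_on)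
  ultimately have "norm (P c) \<le> 0"
    using maximum_modulus_frontier[of P "cball c \<rho>" 0 c] \<rho>(1) by auto
  moreover have "P c = of_real (\<rho>\<^sup>2) ^ n * G n c"
  proof -
    have "P c = (\<Sum>h\<le>n. if h = n then of_real (\<rho>\<^sup>2) ^ n * G n c else 0)"
      unfolding P_def by (intro sum.cong refl) auto
    then show ?thesis by simp
  qed
  ultimately show ?thesis using \<rho>(1) by simp
qed

lemma polyanalytic_unique:
  fixes G :: "nat \<Rightarrow> complex \<Rightarrow> complex"
  assumes "open U" and "\<And>h. h < n \<Longrightarrow> G h holomorphic_on U"
    and "\<And>z. z \<in> U \<Longrightarrow> (\<Sum>h<n. cnj z ^ h * G h z) = 0"
    and "h < n" "z \<in> U"
  shows "G h z = 0"
  using assms(2-5)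
proof (induction n arbitrary: h z)
  case (Suc n)
  have lead: "G n c = 0" if "c \<in> U" for c
  proof (rule polyanalytic_leading_zero[OF assms(1) _ _ that])
    show "G h holomorphic_on U" if "h \<le> n" for h
      using Suc.prems(1) that by simp
    show "(\<Sum>h\<le>n. cnj z ^ h * G h z) = 0" if "z \<in> U" for z
      using Suc.prems(2)[OF that] by (simp only: lessThan_Suc_atMost)
  qed
  then have "(\<Sum>h<n. cnj c ^ h * G h c) = 0" if "c \<in> U" for c
    using Suc.prems(2)[OF that] that by simp
  then show ?case
    using lead[OF Suc.prems(4)] Suc.IH[of h z] Suc.prems less_Suc_eq by auto
qed simp

lemma holomorphic_zero_on_reals:
  assumes "F holomorphic_on ball (of_real r) \<epsilon>"
    and "\<And>t. of_real t \<in> ball (of_real r :: complex) \<epsilon> \<Longrightarrow> F (of_real t) = 0"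
    and "z \<in> ball (of_real r) \<epsilon>"
  shows "F z = 0"
proof (rule analytic_continuation[OF assms(1)])
  have "\<epsilon> > 0" using assms(3) by (metis ball_eq_empty empty_iff not_le)
  let ?U = "complex_of_real ` {r - \<epsilon> <..< r + \<epsilon>}"
  show "?U \<subseteq> ball (of_real r) \<epsilon>"
    by (auto simp: dist_norm simp flip: of_real_diff)
  show "complex_of_real r islimpt ?U"
    unfolding islimpt_approachable
  proof (intro allI impI)
    fix e :: real assume "e > 0"
    define t where "t = r + min e \<epsilon> / 2"
    have "r < t" "t < r + \<epsilon>" "t < r + e"
      using \<open>e > 0\<close> \<open>\<epsilon> > 0\<close> by (auto simp: t_def min_def)
    then have "of_real t \<in> ?U" "complex_of_real t \<noteq> of_real r" "dist (complex_of_real t) (of_real r) < e"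
      using \<open>\<epsilon> > 0\<close> by (auto simp: dist_norm simp flip: of_real_diff)
    then show "\<exists>x'\<in>?U. x' \<noteq> complex_of_real r \<and> dist x' (of_real r) < e" by blast
  qed
  show "F x = 0" if "x \<in> ?U" for x
    using that assms(2) \<open>?U \<subseteq> _\<close> by blast
qed (use assms(3) in \<open>auto intro: order_le_less_trans[OF zero_le_dist]\<close>)

section \<open>Passing from one slice to another\<close>

text \<open>
  The slices \<open>I\<close> and \<open>J\<close> communicate through the real points of the ball: the vanishing sum on
  slice \<open>I\<close> kills every coefficient at these points, and the identity theorem on slice \<open>J\<close>
  propagates the zeros from there.
\<close>

lemma slice_combination_zero_transfer:
  assumes ball: "ball (of_real r) \<epsilon> \<subseteq> \<Omega>"
    and hol: "\<And>h I w. h < n \<Longrightarrow> I \<in> imag_units \<Longrightarrow>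
      (\<lambda>z. slice_coord I w (g h (slice_embed I z))) holomorphic_on (slice_embed I -` \<Omega>)"
    and I: "I \<in> imag_units"
    and zero: "\<And>x. x \<in> \<Omega> \<inter> slice_plane I \<Longrightarrow> (\<Sum>h<n. qcnj x ^ h * g h x) = 0"
    and J: "J \<in> imag_units" and x: "x \<in> ball (of_real r) \<epsilon> \<inter> slice_plane J" and "h < n"
  shows "g h x = 0"
proof -
  let ?B = "ball (complex_of_real r) \<epsilon>"
  have emb: "slice_embed K z \<in> ball (of_real r) \<epsilon> \<longleftrightarrow> z \<in> ?B" if "K \<in> imag_units" for K z
    using dist_of_real_slice_embed[OF that] by simp
  have sub: "?B \<subseteq> slice_embed K -` \<Omega>" if "K \<in> imag_units" for K
    using ball emb[OF that] by blast
  have conj: "qcnj (slice_embed I z) ^ k = slice_embed I (cnj z ^ k)" for z k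
  proof (induction k)
    case (Suc k)
    have "qcnj (slice_embed I z) = slice_embed I (cnj z)"
      using imag_units_sel[OF I] by (simp add: slice_embed_def quat_eq_iff)
    moreover have "slice_embed I a * slice_embed I b = slice_embed I (a * b)" for a b
      using imag_units_sel[OF I]
      by (simp add: slice_embed_def quat_eq_iff power2_eq_square) algebra
    ultimately show ?case using Suc by simp
  qed (simp add: slice_embed_def)
  have real: "g k (of_real t) = 0" if "k < n" "of_real t \<in> ?B" for k t
  proof (rule slice_coord_eqD[of I])
    fix w
    have "slice_coord I w (g k (slice_embed I (of_real t))) = 0"
    proof (rule polyanalytic_unique[of ?B n "\<lambda>k z. slice_coord I w (g k (slice_embed I z))"])
      show "(\<lambda>z. slice_coord I w (g k (slice_embed I z))) holomorphic_on ?B" if "k < n" for k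
        using hol[OF that I] sub[OF I] holomorphic_on_subset by blast
      fix z assume "z \<in> ?B"
      then have "(\<Sum>k<n. qcnj (slice_embed I z) ^ k * g k (slice_embed I z)) = 0"
        using sub[OF I] by (intro zero) (auto simp: slice_plane_eq_range)
      then have "slice_coord I w (\<Sum>k<n. slice_embed I (cnj z ^ k) * g k (slice_embed I z)) = 0"
        by (simp only: conj slice_coord_linear_simps)
      then show "(\<Sum>k<n. cnj z ^ k * slice_coord I w (g k (slice_embed I z))) = 0"
        by (simp add: slice_coord_mult[OF I])
    qed (use that in auto)
    then show "slice_coord I w (g k (of_real t)) = slice_coord I w 0"
      by simp
  qed
  obtain z where z: "x = slice_embed J z" "z \<in> ?B"
    using x emb[OF J] by (auto simp: slice_plane_eq_range)
  show ?thesis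
  proof (rule slice_coord_eqD[of J])
    fix w
    have "slice_coord J w (g h (slice_embed J z)) = 0"
    proof (rule holomorphic_zero_on_reals[of
          "\<lambda>z. slice_coord J w (g h (slice_embed J z))" r \<epsilon>])
      show "(\<lambda>z. slice_coord J w (g h (slice_embed J z))) holomorphic_on ?B"
        using hol[OF \<open>h < n\<close> J] sub[OF J] holomorphic_on_subset by blast
    qed (use z real \<open>h < n\<close> in auto)
    then show "slice_coord J w (g h x) = slice_coord J w 0"
      by (simp add: z)
  qed
qed

lemma global_slice_polyanalytic_eq_id:
  assumes ball: "ball (of_real r) \<epsilon> \<subseteq> \<Omega>"
    and f: "f \<in> global_slice_polyanalytic n \<Omega>" and "n \<ge> 1"
    and I: "I \<in> imag_units" and id: "\<And>x. x \<in> \<Omega> \<inter> slice_plane I \<Longrightarrow> f x = x"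
    and J: "J \<in> imag_units" and x: "x \<in> ball (of_real r) \<epsilon> \<inter> slice_plane J"
  shows "f x = x"
proof -
  obtain F where F: "\<And>h. h < n \<Longrightarrow> F h \<in> slice_regular \<Omega>"
    and sum: "\<And>x. x \<in> \<Omega> \<Longrightarrow> f x = (\<Sum>h<n. qcnj x ^ h * F h x)"
    using f by (auto simp: global_slice_polyanalytic_def)
  \<comment> \<open>The identity is slice regular, so it can be absorbed into the coefficient of order zero.\<close>
  define g where "g h x = F h x - (if h = 0 then x else 0)" for h x
  have sum_g: "(\<Sum>h<n. qcnj x ^ h * g h x) = f x - x" if "x \<in> \<Omega>" for x
  proof -
    have "qcnj x ^ h * g h x = qcnj x ^ h * F h x - (if h = 0 then x else 0)" for h
      by (simp add: g_def right_diff_distrib)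
    then show ?thesis
      using that sum \<open>n \<ge> 1\<close> by (simp add: sum_subtractf)
  qed
  have "(\<lambda>z. slice_coord K w (g h (slice_embed K z))) holomorphic_on (slice_embed K -` \<Omega>)"
    if h: "h < n" and K: "K \<in> imag_units" for h K w
  proof -
    have "slice_coord K w (g h (slice_embed K z))
        = slice_coord K w (F h (slice_embed K z)) - (if h = 0 then z * slice_coord K w 1 else 0)" for z
      using slice_coord_mult[OF K, of w z 1]
      by (simp add: g_def)
    moreover have "(\<lambda>z. slice_coord K w (F h (slice_embed K z))
        - (if h = 0 then z * slice_coord K w 1 else 0)) holomorphic_on (slice_embed K -` \<Omega>)"
      using slice_regular_holomorphic[OF F[OF h] K, of w]
      by (cases "h = 0") (auto intro!: holomorphic_intros)
    ultimately show ?thesis by simp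
  qed
  moreover have "(\<Sum>h<n. qcnj x ^ h * g h x) = 0" if "x \<in> \<Omega> \<inter> slice_plane I" for x
    using that sum_g id by auto
  ultimately have "g h x = 0" if "h < n" for h
    by (intro slice_combination_zero_transfer[where g = g, OF ball _ I _ J x that])
  then show ?thesis
    using sum_g[of x] x ball by auto
qed

section \<open>The map \<open>v\<close> separates the two notions\<close>

theorem mainTheorem3:
  fixes \<Omega> :: "quat set" and v :: "quat \<Rightarrow> quat"
  assumes "\<Omega> \<noteq> {}" and "open \<Omega>" and "connected \<Omega>" and "circular \<Omega>" and "\<Omega> \<inter> \<real> \<noteq> {}"
    and "\<forall>x\<in>\<Omega>. v x = - quat_i * x * quat_i"
  shows "v \<in> (\<Inter>n\<in>{2..}. slice_polyanalytic n \<Omega>)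
    \<and> v \<notin> (\<Union>n\<in>{1..}. global_slice_polyanalytic n \<Omega>)
    \<and> \<not> slice_function \<Omega> v
    \<and> (v \<in> (\<Inter>n\<in>{2..}. slice_polyanalytic n \<Omega>) \<and>
       (\<lambda>x. x) \<in> (\<Inter>n\<in>{2..}. slice_polyanalytic n \<Omega>) \<and>
       (\<exists>x\<in>\<Omega>. v x \<noteq> x) \<and>
       (\<forall>x\<in>\<Omega> \<inter> slice_plane quat_i. v x = x))
    \<and> (\<forall>\<alpha>\<^sub>0 \<beta>\<^sub>0 :: real. Complex \<alpha>\<^sub>0 \<beta>\<^sub>0 \<in> slice_domain \<Omega> \<and> \<beta>\<^sub>0 > 0 \<longrightarrow>
        \<not> (\<exists>a\<^sub>0 b\<^sub>0 :: quat. \<forall>I\<in>imag_units.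
              v (of_real \<alpha>\<^sub>0 + I * of_real \<beta>\<^sub>0) = a\<^sub>0 + I * b\<^sub>0))"
proof -
  have v: "v x = - quat_i * x * quat_i" if "x \<in> \<Omega>" for x
    using assms(6) that by blast
  have "bounded_linear (\<lambda>x. - quat_i * x * quat_i)"
    by (intro bounded_linear_mult_const bounded_linear_const_mult bounded_linear_ident)
  then have SP: "v \<in> (\<Inter>n\<in>{2..}. slice_polyanalytic n \<Omega>)"
    using slice_polyanalytic_linear[OF assms(2)] v by auto
  have SP_id: "(\<lambda>x. x) \<in> (\<Inter>n\<in>{2..}. slice_polyanalytic n \<Omega>)"
    using slice_polyanalytic_linear[OF assms(2) bounded_linear_ident] by auto
  have v_i: "v x = x" if "x \<in> \<Omega> \<inter> slice_plane quat_i" for x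
    using that v by (auto simp: slice_plane_def quat_eq_iff)
  obtain r where "of_real r \<in> \<Omega>"
    using assms(5) by (auto simp: Reals_def)
  then obtain \<epsilon> where "\<epsilon> > 0" and ball: "ball (of_real r) \<epsilon> \<subseteq> \<Omega>"
    using assms(2) open_contains_ball by blast
  \<comment> \<open>The half radius keeps the sphere through \<open>z\<close> in the ball around the real point and off the axis.\<close>
  define z where "z = Complex r (\<epsilon> / 2)"
  have emb: "slice_embed I z \<in> ball (of_real r) \<epsilon>" if "I \<in> imag_units" for I
  proof -
    have "dist (of_real r) (slice_embed I z) = norm (of_real r - z)"
      using dist_of_real_slice_embed[OF that] by (simp add: dist_norm)
    also have "of_real r - z = - (\<i> * of_real (\<epsilon> / 2))"
      by (simp add: z_def complex_eq_iff)
    finally show ?thesis using \<open>\<epsilon> > 0\<close> by (simp add: norm_mult)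
  qed
  then have z: "z \<in> slice_domain \<Omega>"
    using ball by (auto simp: slice_domain_def)
  have v_j: "v (slice_embed quat_j z) \<noteq> slice_embed quat_j z"
  proof -
    have "slice_embed quat_j z \<in> \<Omega>" using emb ball by auto
    then show ?thesis
      using v \<open>\<epsilon> > 0\<close> by (simp add: slice_embed_def z_def quat_eq_iff del: of_real_divide)
  qed
  have "v \<notin> global_slice_polyanalytic n \<Omega>" if "n \<ge> 1" for n
  proof
    assume "v \<in> global_slice_polyanalytic n \<Omega>"
    then have "v (slice_embed quat_j z) = slice_embed quat_j z"
      by (rule global_slice_polyanalytic_eq_id[OF ball _ that, where I = quat_i and J = quat_j])
        (use v_i emb in \<open>auto simp: slice_plane_eq_range\<close>)
    then show False using v_j by blast
  qed
  moreover have no_affine: "\<not> (\<exists>a b. \<forall>I\<in>imag_units. v (of_real \<alpha> + I * of_real \<beta>) = a + I * b)"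
    if "Complex \<alpha> \<beta> \<in> slice_domain \<Omega>" "\<beta> > 0" for \<alpha> \<beta>
  proof
    assume "\<exists>a b. \<forall>I\<in>imag_units. v (of_real \<alpha> + I * of_real \<beta>) = a + I * b"
    then obtain a b where ab: "\<And>I. I \<in> imag_units \<Longrightarrow> v (of_real \<alpha> + I * of_real \<beta>) = a + I * b"
      by blast
    have "- quat_i * (of_real \<alpha> + I * of_real \<beta>) * quat_i = a + I * b" if "I \<in> imag_units" for I
      using ab[OF that] v \<open>Complex \<alpha> \<beta> \<in> _\<close> that by (simp add: slice_domain_def slice_embed_def)
    from this[of quat_i] this[of "- quat_i"] this[of quat_j] show False
      using \<open>\<beta> > 0\<close> by (simp add: quat_eq_iff)
  qed
  moreover have "\<not> slice_function \<Omega> v"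
  proof
    assume "slice_function \<Omega> v"
    then have "\<exists>a b. \<forall>I\<in>imag_units. v (slice_embed I z) = a + I * b"
      using z unfolding slice_function_def by blast
    then show False
      using no_affine[of "r" "\<epsilon> / 2"] z \<open>\<epsilon> > 0\<close> by (simp add: slice_embed_def z_def)
  qed
  moreover have "\<exists>x\<in>\<Omega>. v x \<noteq> x"
    using v_j emb[of quat_j] ball by auto
  ultimately show ?thesis
    using SP SP_id v_i by auto
qed

end
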